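(* Let $(a_n)_{n\ge0}$ be the sequence, listed in increasing order, of the non-negative integers $m$ such that $15m+4$ is a perfect square. Then $$\sum_{n=0}^\infty(-1)^{\lfloor (n+2)/4\rfloor}q^{a_n}=\frac{(q^2,q^6,q^8;q^8)_\infty\,(q^4,q^{12};q^{16})_\infty}{(q^2,q^3;q^5)_\infty}.$$
   Context: Here $q$ is a complex number with $|q|<1$ (equivalently, the identity may be read as an identity of formal power series in $q$). For a complex number $a$, $(a;q)_\infty:=\prod_{i=0}^\infty(1-aq^i)$, and $(a_1,a_2,\dots,a_m;q)_\infty:=\prod_{j=1}^m(a_j;q)_\infty$. $\lfloor x\rfloor$ is the floor function. *)

theory Defs
  imports "HOL-Analysis.Analysis" "HOL-Computational_Algebra.Nth_Powers"
begin

definition qpoch_inf :: "complex \<Rightarrow> complex \<Rightarrow> complex" where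
  "qpoch_inf a q = (\<Prod>i. 1 - a * q ^ i)"

definition qpochs_inf :: "complex list \<Rightarrow> complex \<Rightarrow> complex" where
  "qpochs_inf as q = (\<Prod>a\<leftarrow>as. qpoch_inf a q)"

definition square_indices :: "nat set" where
  "square_indices = {m. is_square (15 * m + 4)}"

definition a_seq :: "nat \<Rightarrow> nat" where
  "a_seq n = enumerate square_indices n"

(* enumerate lists a set in increasing order only if the set is infinite. *)

lemma infinite_square_indices: "infinite square_indices"
proof -
  have "15 * j\<^sup>2 + 4 * j \<in> square_indices" for j
  proof -
    have "15 * (15 * j\<^sup>2 + 4 * j) + 4 = (15 * j + 2)\<^sup>2"
      by (simp add: power2_eq_square algebra_simps)
    then show ?thesis
      unfolding square_indices_def by (metis is_nth_power_nth_power mem_Collect_eq)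
  qed
  moreover have "j \<le> 15 * j\<^sup>2 + 4 * j" for j :: nat
    by simp
  ultimately show ?thesis
    unfolding infinite_nat_iff_unbounded_le by blast
qed

lemma strict_mono_a_seq: "strict_mono a_seq"
  unfolding a_seq_def
  by (simp add: strict_mono_def infinite_square_indices)

lemma range_a_seq: "range a_seq = square_indices"
  using range_enumerate[OF infinite_square_indices] by (simp add: a_seq_def[abs_def])

end

theory Submission
  imports Defs
begin

text \<open>
  The numerator on the right is \<open>(q\<^sup>2;q\<^sup>2)\<^sub>\<infinity>\<close>. Splitting numerator and denominator modulo 10, the right-hand
  side becomes \<open>(p, z\<^sup>2, p/z\<^sup>2; p)\<^sub>\<infinity> / (z, p/z; p)\<^sub>\<infinity>\<close> with \<open>p = q\<^bsup>10\<^esup>\<close> and \<open>z = q\<^sup>3\<close>, which the quintuple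
  product identity expands as \<open>\<Sum>k\<in>\<int>. (-1)\<^bsup>k\<^esup> (1 + z p\<^bsup>k\<^esup>) z\<^bsup>3k\<^esup> p\<^bsup>k(3k-1)/2\<^esup>\<close>. Its exponents are
  \<open>15k\<^sup>2 + 4k = ((15k+2)\<^sup>2 - 4)/15\<close> and \<open>15k\<^sup>2 + 14k + 3 = ((15k+7)\<^sup>2 - 4)/15\<close>; the indices \<open>k = j\<close> and
  \<open>k = -j-1\<close> together contribute the four consecutive terms \<open>n = 4j, \<dots>, 4j+3\<close> of the series.

  The quintuple product itself is the limit, via Tannery's theorem, of the finite identity of
  Chen, Chu and Gu
  \<open>\<Sum>k\<le>n. [n choose k]\<^sub>q (1 + x q\<^bsup>k\<^esup>) (x;q)\<^bsub>n+1\<^esub> / (x\<^sup>2q\<^bsup>k\<^esup>;q)\<^bsub>n+1\<^esub> x\<^bsup>k\<^esup> q\<^bsup>k\<^sup>2\<^esup> = 1\<close>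
  at \<open>n = 2m\<close>, \<open>x = z/q\<^bsup>m\<^esup>\<close>.
\<close>

section \<open>A finite quintuple product identity\<close>

definition qpoch :: "complex \<Rightarrow> complex \<Rightarrow> nat \<Rightarrow> complex" where
  "qpoch a q n = (\<Prod>i<n. 1 - a * q ^ i)"

lemma qpoch_0 [simp]: "qpoch a q 0 = 1"
  by (simp add: qpoch_def)

lemma qpoch_Suc: "qpoch a q (Suc n) = qpoch a q n * (1 - a * q ^ n)"
  by (simp add: qpoch_def)

lemma qpoch_Suc_shift: "qpoch a q (Suc n) = (1 - a) * qpoch (a * q) q n"
  unfolding qpoch_def prod.lessThan_Suc_shift by (simp add: mult_ac)

lemma qpoch_add: "qpoch a q (m + n) = qpoch a q m * qpoch (a * q ^ m) q n"
  by (induction n) (simp_all add: qpoch_Suc power_add mult_ac)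

lemma qpoch_nonzero:
  assumes "\<And>i. a * q ^ i \<noteq> 1"
  shows "qpoch a q n \<noteq> 0"
  using assms by (force simp: qpoch_def)

text \<open>The base is written as \<open>r\<^sup>2\<close> so that the triangular exponents of the base need no halving.\<close>

lemma qpoch_divide_power:
  assumes "r \<noteq> 0" "y \<noteq> 0"
  shows "qpoch (y / (r\<^sup>2) ^ m) (r\<^sup>2) (m + n) =
    (-y) ^ m / r ^ (m * Suc m) * qpoch (r\<^sup>2 / y) (r\<^sup>2) m * qpoch y (r\<^sup>2) n"
proof (induction m)
  case (Suc m)
  have "qpoch (y / (r\<^sup>2) ^ Suc m) (r\<^sup>2) (Suc m + n) =
      (1 - y / (r\<^sup>2) ^ Suc m) * qpoch (y / (r\<^sup>2) ^ m) (r\<^sup>2) (m + n)"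
    using assms by (simp add: qpoch_Suc_shift)
  also have "\<dots> = (1 - y / (r\<^sup>2) ^ Suc m) * ((-y) ^ m / r ^ (m * Suc m)) *
      qpoch (r\<^sup>2 / y) (r\<^sup>2) m * qpoch y (r\<^sup>2) n"
    by (simp add: Suc.IH)
  \<comment> \<open>The new lowest factor is reversed by \<open>1 - a = - a * (1 - 1 / a)\<close>
    and becomes the next factor of \<open>qpoch (r\<^sup>2 / y)\<close>; the factors
    \<open>- a\<close> accumulate in the prefactor.\<close>
  also have "(1 - y / (r\<^sup>2) ^ Suc m) * ((-y) ^ m / r ^ (m * Suc m)) =
      (-y) ^ Suc m / r ^ (Suc m * Suc (Suc m)) * (1 - r\<^sup>2 / y * (r\<^sup>2) ^ m)"
  proof -
    have e: "r ^ (Suc m * Suc (Suc m)) = r ^ (m * Suc m) * (r\<^sup>2) ^ Suc m"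
    proof -
      have "Suc m * Suc (Suc m) = m * Suc m + 2 * Suc m"
        by simp
      then show ?thesis
        by (simp only: power_add power_mult)
    qed
    have "1 - y / (r\<^sup>2) ^ Suc m = (-y) / (r\<^sup>2) ^ Suc m * (1 - r\<^sup>2 / y * (r\<^sup>2) ^ m)"
      using assms by (simp add: field_simps)
    then show ?thesis
      unfolding e by (simp add: mult_ac)
  qed
  finally show ?case
    by (simp add: qpoch_Suc)
qed auto

definition quint_term :: "complex \<Rightarrow> complex \<Rightarrow> nat \<Rightarrow> nat \<Rightarrow> complex" where
  "quint_term q x n k =
     qpoch q q n / (qpoch q q k * qpoch q q (n - k)) * (1 + x * q ^ k)
     * qpoch x q (Suc n) / qpoch (x\<^sup>2 * q ^ k) q (Suc n) * x ^ k * q ^ k\<^sup>2"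

text \<open>A WZ certificate: the differences \<open>quint_term q x (n + 1) k - quint_term q x n k\<close> telescope in \<open>k\<close>.\<close>

definition quint_cert :: "complex \<Rightarrow> complex \<Rightarrow> nat \<Rightarrow> nat \<Rightarrow> complex" where
  "quint_cert q x n k =
     - (qpoch q q n / (qpoch q q k * qpoch q q (n - k)) * qpoch x q (Suc n)
     / qpoch (x\<^sup>2 * q ^ Suc k) q (Suc n) * x ^ Suc k * q ^ ((Suc k)\<^sup>2 + (n - k)))"

text \<open>These assumptions keep every denominator of \<open>quint_term\<close> and
  \<open>quint_cert\<close> nonzero.\<close>

context
  fixes q x :: complex
  assumes q: "\<And>i. q ^ Suc i \<noteq> 1" and x: "\<And>i. x\<^sup>2 * q ^ i \<noteq> 1"
begin

lemma qpoch_base_nonzero: "qpoch q q n \<noteq> 0"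
  by (rule qpoch_nonzero) (use q in simp)

lemma qpoch_square_nonzero: "qpoch (x\<^sup>2 * q ^ k) q n \<noteq> 0"
  by (rule qpoch_nonzero) (use x[of "k + _"] in \<open>simp add: power_add mult_ac\<close>)

text \<open>All four quantities are a common factor \<open>C\<close> times a polynomial in
  \<open>q\<close>, \<open>x\<close>, \<open>u\<close> and \<open>v\<close>, so the recurrence
  reduces to one polynomial identity. Writing \<open>n\<close> as \<open>Suc k + d\<close> removes
  the truncated subtractions.\<close>

lemma quint_cert_step:
  assumes "Suc k \<le> n"
  shows "quint_cert q x n (Suc k) - quint_cert q x n k =
    quint_term q x (Suc n) (Suc k) - quint_term q x n (Suc k)"
proof -
  obtain d where n: "n = Suc k + d"
    using assms le_Suc_ex by blast
  define u where "u = q ^ k"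
  define v where "v = q ^ d"
  \<comment> \<open>\<open>M\<close> is the block of factors shared by all the denominators in
    \<open>x\<^sup>2\<close>; \<open>c1\<close> and \<open>c2\<close> are the factors just before
    and just after that block.\<close>
  define M where "M = qpoch (x\<^sup>2 * q ^ Suc (Suc k)) q n"
  define E where "E = q ^ (Suc k)\<^sup>2"
  define c1 where "c1 = 1 - x\<^sup>2 * u * q"
  define c2 where "c2 = 1 - x\<^sup>2 * u\<^sup>2 * v * q ^ 3"
  define du where "du = 1 - u * q"
  define dv where "dv = 1 - v * q"
  define C where "C = qpoch q q n * qpoch x q (Suc n) * x ^ Suc k * E
    / (qpoch q q k * qpoch q q d * du * dv * c1 * c2 * M)"
  have nz: "qpoch q q k \<noteq> 0" "qpoch q q d \<noteq> 0" "M \<noteq> 0"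
    unfolding M_def by (rule qpoch_base_nonzero qpoch_square_nonzero)+
  have "x\<^sup>2 * q ^ (k + k + d + 3) = x\<^sup>2 * u\<^sup>2 * v * q ^ 3"
    by (simp only: u_def v_def power_add power2_eq_square mult_ac)
  then have nz': "c1 \<noteq> 0" "c2 \<noteq> 0" "du \<noteq> 0" "dv \<noteq> 0"
    using x[of "Suc k"] x[of "k + k + d + 3"] q[of k] q[of d]
    by (auto simp: c1_def c2_def du_def dv_def u_def v_def mult_ac)
  have pk: "qpoch q q (Suc k) = qpoch q q k * du"
    and pd: "qpoch q q (Suc d) = qpoch q q d * dv"
    and pn: "qpoch q q (Suc n) = qpoch q q n * (1 - u * v * q\<^sup>2)"
    and px: "qpoch x q (Suc (Suc n)) = qpoch x q (Suc n) * (1 - x * u * v * q\<^sup>2)"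
    by (simp_all add: qpoch_Suc du_def dv_def u_def v_def n power_add power2_eq_square mult_ac)
  have b1: "qpoch (x\<^sup>2 * q ^ Suc k) q (Suc n) = c1 * M"
    by (simp add: qpoch_Suc_shift M_def c1_def u_def mult_ac)
  have b2: "qpoch (x\<^sup>2 * q ^ Suc (Suc k)) q (Suc n) = c2 * M"
    by (simp add: qpoch_Suc M_def c2_def u_def v_def n power_add power2_eq_square
        eval_nat_numeral mult_ac)
  have b3: "qpoch (x\<^sup>2 * q ^ Suc k) q (Suc (Suc n)) = c1 * c2 * M"
    using b2 by (subst qpoch_Suc_shift) (simp add: c1_def u_def mult_ac)
  have e1: "q ^ ((Suc k)\<^sup>2 + (n - k)) = E * v * q"
    by (simp add: n E_def v_def power_add)
  have e2: "q ^ ((Suc (Suc k))\<^sup>2 + (n - Suc k)) = E * u\<^sup>2 * v * q ^ 3"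
    by (simp add: n E_def u_def v_def power_add power2_eq_square eval_nat_numeral mult_ac)
  have t1: "quint_term q x (Suc n) (Suc k) =
      C * ((1 - u * v * q\<^sup>2) * (1 + x * u * q) * (1 - x * u * v * q\<^sup>2))"
    unfolding quint_term_def pn px b3 C_def using nz nz'
    by (simp add: n pd pk field_simps E_def u_def)
  have t2: "quint_term q x n (Suc k) = C * (dv * (1 + x * u * q) * c2)"
    unfolding quint_term_def b1 C_def using nz nz'
    by (simp add: n pk field_simps E_def u_def)
  have g1: "quint_cert q x n (Suc k) = - (C * (dv * x * u\<^sup>2 * q ^ 3 * v * c1))"
    unfolding quint_cert_def b2 e2 C_def using nz nz'
    by (simp add: n pk field_simps)
  have g2: "quint_cert q x n k = - (C * (du * v * q * c2))"
    unfolding quint_cert_def b1 e1 C_def using nz nz'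
    by (simp add: n pd field_simps)
  have "- (dv * x * u\<^sup>2 * q ^ 3 * v * c1) + du * v * q * c2 =
      (1 - u * v * q\<^sup>2) * (1 + x * u * q) * (1 - x * u * v * q\<^sup>2) - dv * (1 + x * u * q) * c2"
    unfolding c1_def c2_def du_def dv_def by algebra
  then show ?thesis
    unfolding t1 t2 g1 g2 by (metis (no_types, lifting) diff_minus_eq_add mult_minus_right
        right_diff_distrib)
qed

text \<open>The start of the telescoping: the certificate at index -1 counts as zero.\<close>

lemma quint_cert_0: "quint_cert q x n 0 = quint_term q x (Suc n) 0 - quint_term q x n 0"
proof -
  define M where "M = qpoch (x\<^sup>2 * q) q n"
  define c where "c = 1 - x\<^sup>2 * q * q ^ n"
  have nz: "M \<noteq> 0" "qpoch q q n \<noteq> 0" "qpoch q q (Suc n) \<noteq> 0"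
    using qpoch_square_nonzero[of 1 n] qpoch_base_nonzero[of n] qpoch_base_nonzero[of "Suc n"]
    by (simp_all add: M_def)
  have nz': "c \<noteq> 0" "1 - x\<^sup>2 \<noteq> 0"
    using x[of 0] x[of "Suc n"] by (auto simp: c_def mult_ac)
  have b2: "qpoch (x\<^sup>2 * q) q (Suc n) = c * M"
    by (simp add: qpoch_Suc M_def c_def)
  have b1: "qpoch (x\<^sup>2) q (Suc n) = (1 - x\<^sup>2) * M"
    by (simp add: qpoch_Suc_shift M_def)
  have b3: "qpoch (x\<^sup>2) q (Suc (Suc n)) = (1 - x\<^sup>2) * c * M"
    using b2 by (subst qpoch_Suc_shift) simp
  have px: "qpoch x q (Suc (Suc n)) = qpoch x q (Suc n) * (1 - x * q * q ^ n)"
    by (simp add: qpoch_Suc[of _ _ "Suc n"] mult_ac)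
  define P where "P = qpoch x q (Suc n)"
  have "(1 - x\<^sup>2) * (- x * q * q ^ n) = (1 + x) * (1 - x * q * q ^ n) - (1 + x) * c"
    unfolding c_def by algebra
  then have "P * ((1 - x\<^sup>2) * (- x * q * q ^ n)) / ((1 - x\<^sup>2) * c * M) =
      P * ((1 + x) * (1 - x * q * q ^ n) - (1 + x) * c) / ((1 - x\<^sup>2) * c * M)"
    by simp
  moreover have "quint_cert q x n 0 = P * ((1 - x\<^sup>2) * (- x * q * q ^ n)) / ((1 - x\<^sup>2) * c * M)"
    unfolding quint_cert_def using nz nz' by (simp add: b2 P_def[symmetric])
  moreover have "quint_term q x (Suc n) 0 = P * ((1 + x) * (1 - x * q * q ^ n)) / ((1 - x\<^sup>2) * c * M)"
    unfolding quint_term_def px P_def[symmetric] using nz nz' by (simp add: b3)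
  moreover have "quint_term q x n 0 = P * ((1 + x) * c) / ((1 - x\<^sup>2) * c * M)"
    unfolding quint_term_def P_def[symmetric] using nz nz' by (simp add: b1)
  ultimately show ?thesis
    by (simp add: right_diff_distrib diff_divide_distrib)
qed

lemma sum_quint_term_diff:
  "k \<le> n \<Longrightarrow> (\<Sum>i\<le>k. quint_term q x (Suc n) i - quint_term q x n i) = quint_cert q x n k"
proof (induction k)
  case (Suc k)
  then show ?case
    using quint_cert_step[of k n] by (simp add: algebra_simps)
qed (simp add: quint_cert_0)

text \<open>Passing from \<open>n\<close> to \<open>Suc n\<close> adds one summand, and this summand
  cancels the boundary value left by the telescoping. The factors \<open>1 + x * q ^ Suc n\<close>
  and \<open>1 - x * q ^ Suc n\<close> multiply to the last factor of the denominator.\<close>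

lemma quint_term_top: "quint_term q x (Suc n) (Suc n) = - quint_cert q x n n"
proof -
  define c where "c = 1 - (x * q * q ^ n)\<^sup>2"
  define M where "M = qpoch (x\<^sup>2 * q ^ Suc n) q (Suc n)"
  have "M \<noteq> 0" unfolding M_def by (rule qpoch_square_nonzero)
  have "c \<noteq> 0"
    using x[of "Suc n + Suc n"] by (auto simp: c_def power_add power_mult_distrib power2_eq_square mult_ac)
  have b: "qpoch (x\<^sup>2 * q ^ Suc n) q (Suc (Suc n)) = c * M"
    by (simp add: qpoch_Suc[of _ _ "Suc n"] M_def c_def power2_eq_square mult_ac)
  have px: "qpoch x q (Suc (Suc n)) = qpoch x q (Suc n) * (1 - x * q * q ^ n)"
    by (simp add: qpoch_Suc[of _ _ "Suc n"] mult_ac)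
  have c: "(1 + x * q * q ^ n) * (1 - x * q * q ^ n) = c"
    by (simp add: c_def power2_eq_square algebra_simps)
  have "quint_term q x (Suc n) (Suc n) =
      qpoch x q (Suc n) * ((1 + x * q * q ^ n) * (1 - x * q * q ^ n)) / (c * M)
      * x ^ Suc n * q ^ (Suc n)\<^sup>2"
    unfolding quint_term_def px b using qpoch_base_nonzero[of "Suc n"] by (simp add: mult_ac)
  also have "\<dots> = - quint_cert q x n n"
    unfolding c quint_cert_def M_def[symmetric] using \<open>c \<noteq> 0\<close> qpoch_base_nonzero[of n] by simp
  finally show ?thesis .
qed

text \<open>By the telescoping and the cancellation at the top, the sum does not depend on
  \<open>n\<close>, and for \<open>n = 0\<close> it is 1.\<close>

theorem finite_quintuple_product: "(\<Sum>k\<le>n. quint_term q x n k) = 1"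
proof (induction n)
  case 0
  have "(1 + x) * (1 - x) = 1 - x\<^sup>2" "1 - x\<^sup>2 \<noteq> 0"
    using x[of 0] by (auto simp: power2_eq_square algebra_simps)
  then show ?case
    by (simp add: quint_term_def qpoch_Suc)
next
  case (Suc n)
  have "(\<Sum>k\<le>Suc n. quint_term q x (Suc n) k) =
      (\<Sum>k\<le>n. quint_term q x (Suc n) k - quint_term q x n k) + quint_term q x (Suc n) (Suc n)
      + (\<Sum>k\<le>n. quint_term q x n k)"
    by (simp add: sum_subtractf)
  then show ?case
    by (simp add: sum_quint_term_diff quint_term_top Suc.IH)
qed

end

section \<open>The quintuple product identity\<close>

text \<open>The terms of the bilateral series with index \<open>i\<close> and \<open>-i\<close>, respectively.\<close>

definition quint_pos :: "complex \<Rightarrow> complex \<Rightarrow> nat \<Rightarrow> complex" where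
  "quint_pos r z i = (-1) ^ i * (z ^ 3 / r) ^ i * (r ^ 3) ^ i\<^sup>2 * (1 + z * (r\<^sup>2) ^ i)"

definition quint_neg :: "complex \<Rightarrow> complex \<Rightarrow> nat \<Rightarrow> complex" where
  "quint_neg r z i = (-1) ^ i * (r / z ^ 3) ^ i * (r ^ 3) ^ i\<^sup>2 * (1 + z / (r\<^sup>2) ^ i)"

text \<open>The part of the shifted summand that tends to a constant. It is grouped into a factor in
  \<open>m\<close>, a factor in \<open>a\<close> and a factor in \<open>b\<close>, so that each has
  its own limit; it is used with \<open>a + b = 2 * m\<close>.\<close>

definition quint_weight :: "complex \<Rightarrow> complex \<Rightarrow> nat \<Rightarrow> nat \<Rightarrow> nat \<Rightarrow> complex" where
  "quint_weight p z m a b =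
     (qpoch p p (2 * m) * qpoch (p / z) p m * qpoch z p (Suc m))
     * (1 / (qpoch p p a * qpoch (z\<^sup>2) p (Suc a))) * (1 / (qpoch p p b * qpoch (p / z\<^sup>2) p b))"

text \<open>Shifting \<open>x\<close> to \<open>z / p ^ m\<close> with \<open>p = r\<^sup>2\<close>
  moves the centre of the sum to \<open>k = m\<close>. Both Pochhammer symbols in \<open>x\<close>
  then straddle their base point, and \<open>qpoch_divide_power\<close> splits them there.\<close>

lemma quint_term_shift:
  assumes "r \<noteq> 0" "z \<noteq> 0" "k + b = 2 * m"
  shows "quint_term (r\<^sup>2) (z / (r\<^sup>2) ^ m) (2 * m) k =
    (-z) ^ m * r ^ (b * Suc b) * z ^ k * r ^ (2 * k\<^sup>2) / (r ^ (m * Suc m) * (- z\<^sup>2) ^ b * r ^ (2 * m * k))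
    * (1 + z * (r\<^sup>2) ^ k / (r\<^sup>2) ^ m) * quint_weight (r\<^sup>2) z m k b"
proof -
  let ?p = "r\<^sup>2"
  have b: "2 * m - k = b"
    using assms(3) by simp
  have 1: "qpoch (z / ?p ^ m) ?p (Suc (2 * m)) =
      (-z) ^ m / r ^ (m * Suc m) * qpoch (?p / z) ?p m * qpoch z ?p (Suc m)"
    using qpoch_divide_power[OF assms(1,2), of m "Suc m"] by (simp add: mult_2)
  have "(z / ?p ^ m)\<^sup>2 * ?p ^ k = z\<^sup>2 * ?p ^ k / ?p ^ (k + b)"
    using assms(3) by (simp add: power_divide power_mult power_mult_distrib power2_eq_square)
  also have "\<dots> = z\<^sup>2 / ?p ^ b"
    using assms(1) by (simp add: power_add)
  finally have 2: "(z / ?p ^ m)\<^sup>2 * ?p ^ k = z\<^sup>2 / ?p ^ b" .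
  have 3: "qpoch (z\<^sup>2 / ?p ^ b) ?p (Suc (2 * m)) =
      (- z\<^sup>2) ^ b / r ^ (b * Suc b) * qpoch (?p / z\<^sup>2) ?p b * qpoch (z\<^sup>2) ?p (Suc k)"
    using qpoch_divide_power[OF assms(1), of "z\<^sup>2" b "Suc k"] assms by (simp add: add_ac)
  have 4: "(z / ?p ^ m) ^ k = z ^ k / r ^ (2 * m * k)" "?p ^ k\<^sup>2 = r ^ (2 * k\<^sup>2)"
    by (simp_all add: power_divide power_mult)
  show ?thesis
    unfolding quint_term_def 2 3 1 4 b quint_weight_def by (simp add: mult_ac)
qed

text \<open>To the right of the centre, all powers containing \<open>m\<close> cancel, which leaves
  a bilateral term free of \<open>m\<close> times the weight.\<close>

lemma quint_term_pos:
  assumes "r \<noteq> 0" "z \<noteq> 0" "i \<le> m"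
  shows "quint_term (r\<^sup>2) (z / (r\<^sup>2) ^ m) (2 * m) (m + i) =
    quint_pos r z i * quint_weight (r\<^sup>2) z m (m + i) (m - i)"
proof -
  obtain d where m: "m = i + d"
    using assms(3) le_Suc_ex by blast
  \<comment> \<open>The balance of the exponents of \<open>r\<close>; the lone \<open>i\<close> on
    the left comes from the denominator of \<open>z ^ 3 / r\<close>.\<close>
  have e: "d * Suc d + 2 * (m + i)\<^sup>2 + i = m * Suc m + 2 * m * (m + i) + 3 * i\<^sup>2"
    by (simp add: m power2_eq_square algebra_simps)
  have "(-z) ^ m * r ^ (d * Suc d) * z ^ (m + i) * r ^ (2 * (m + i)\<^sup>2) * r ^ i =
     ((-1) ^ m * z ^ (m + (m + i))) * r ^ (d * Suc d + 2 * (m + i)\<^sup>2 + i)"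
    by (simp only: power_add power_minus[of z m] mult_ac)
  also have "\<dots> = ((-1) ^ i * (-1) ^ d * (z ^ 3) ^ i * (z\<^sup>2) ^ d) * r ^ (d * Suc d + 2 * (m + i)\<^sup>2 + i)"
  proof -
    have "m + (m + i) = 3 * i + 2 * d"
      by (simp add: m)
    then show ?thesis
      by (simp only: power_add power_mult m mult.assoc)
  qed
  also have "\<dots> = (-1) ^ i * (z ^ 3) ^ i * (r ^ 3) ^ i\<^sup>2 *
      (r ^ (m * Suc m) * (- z\<^sup>2) ^ d * r ^ (2 * m * (m + i)))"
    unfolding e by (simp only: power_add power_mult power_minus[of "z\<^sup>2" d] mult_ac)
  finally have "(-z) ^ m * r ^ (d * Suc d) * z ^ (m + i) * r ^ (2 * (m + i)\<^sup>2)
      / (r ^ (m * Suc m) * (- z\<^sup>2) ^ d * r ^ (2 * m * (m + i)))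
    = (-1) ^ i * (z ^ 3 / r) ^ i * (r ^ 3) ^ i\<^sup>2"
    using assms by (simp add: field_simps)
  moreover have "z * (r\<^sup>2) ^ (m + i) / (r\<^sup>2) ^ m = z * (r\<^sup>2) ^ i"
    using assms by (simp add: power_add)
  ultimately show ?thesis
    using quint_term_shift[OF assms(1,2), of "m + i" d m] by (simp add: m quint_pos_def)
qed

lemma quint_term_neg:
  assumes "r \<noteq> 0" "z \<noteq> 0" "i \<le> m"
  shows "quint_term (r\<^sup>2) (z / (r\<^sup>2) ^ m) (2 * m) (m - i) =
    quint_neg r z i * quint_weight (r\<^sup>2) z m (m - i) (m + i)"
proof -
  obtain d where m: "m = i + d"
    using assms(3) le_Suc_ex by blast
  have e: "(m + i) * Suc (m + i) + 2 * d\<^sup>2 = m * Suc m + 2 * m * d + 3 * i\<^sup>2 + i"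
    by (simp add: m power2_eq_square algebra_simps)
  have "(-z) ^ m * r ^ ((m + i) * Suc (m + i)) * z ^ d * r ^ (2 * d\<^sup>2) * (z ^ 3) ^ i =
     ((-1) ^ m * (z ^ m * z ^ d * (z ^ 3) ^ i)) * r ^ ((m + i) * Suc (m + i) + 2 * d\<^sup>2)"
    by (simp only: power_add power_minus[of z m] mult_ac)
  \<comment> \<open>The sign and the powers of \<open>z\<close> are rewritten to expose the
    denominator \<open>(- z\<^sup>2) ^ (m + i)\<close>.\<close>
  also have "(-1) ^ m * (z ^ m * z ^ d * (z ^ 3) ^ i) = ((-1) ^ i * (-1) ^ (m + i) * (z\<^sup>2) ^ (m + i))"
  proof -
    have "(-1 :: complex) ^ i * (-1) ^ (m + i) = (-1) ^ m * ((-1) ^ i * (-1) ^ i)"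
      by (simp only: power_add mult_ac)
    also have "\<dots> = (-1) ^ m"
      by (simp flip: power_add)
    finally have "(-1 :: complex) ^ i * (-1) ^ (m + i) = (-1) ^ m" .
    moreover have "m + d + 3 * i = 2 * (m + i)"
      by (simp add: m)
    then have "z ^ m * z ^ d * (z ^ 3) ^ i = (z\<^sup>2) ^ (m + i)"
      by (simp only: power_add[symmetric] power_mult[symmetric])
    ultimately show ?thesis
      by simp
  qed
  also have "\<dots> * r ^ ((m + i) * Suc (m + i) + 2 * d\<^sup>2) = (-1) ^ i * r ^ i * (r ^ 3) ^ i\<^sup>2 *
      (r ^ (m * Suc m) * (- z\<^sup>2) ^ (m + i) * r ^ (2 * m * d))"
    unfolding e by (simp only: power_add power_mult power_minus[of "z\<^sup>2"] mult_ac)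
  finally have "(-z) ^ m * r ^ ((m + i) * Suc (m + i)) * z ^ d * r ^ (2 * d\<^sup>2)
      / (r ^ (m * Suc m) * (- z\<^sup>2) ^ (m + i) * r ^ (2 * m * d))
    = (-1) ^ i * (r / z ^ 3) ^ i * (r ^ 3) ^ i\<^sup>2"
    using assms by (simp add: field_simps)
  moreover have "z * (r\<^sup>2) ^ d / (r\<^sup>2) ^ m = z / (r\<^sup>2) ^ i"
    using assms by (simp add: m power_add)
  ultimately show ?thesis
    using quint_term_shift[OF assms(1,2), of d "m + i" m] by (simp add: m quint_neg_def)
qed

section \<open>Infinite q-shifted factorials\<close>

lemma convergent_prod_qpoch:
  fixes a q :: complex
  assumes "norm q < 1"
  shows "convergent_prod (\<lambda>i. 1 - a * q ^ i)"
proof -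
  have "summable (\<lambda>i. norm a * norm q ^ i)"
    using assms by (intro summable_mult summable_geometric) simp
  then have "summable (\<lambda>i. norm (1 - a * q ^ i - 1))"
    by (simp add: norm_mult norm_power del: summable_cmult_iff)
  then show ?thesis
    by (intro abs_convergent_prod_imp_convergent_prod summable_imp_abs_convergent_prod)
qed

lemma qpoch_LIMSEQ:
  assumes "norm q < 1"
  shows "qpoch a q \<longlonglongrightarrow> qpoch_inf a q"
proof -
  have "(\<lambda>n. qpoch a q (Suc n)) \<longlonglongrightarrow> qpoch_inf a q"
    using convergent_prod_LIMSEQ[OF convergent_prod_qpoch[OF assms, of a]]
    by (simp only: qpoch_def qpoch_inf_def lessThan_Suc_atMost)
  then show ?thesis
    by (rule LIMSEQ_imp_Suc)
qed

lemma qpoch_inf_nonzero: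
  assumes "norm q < 1" "\<And>i. a * q ^ i \<noteq> 1"
  shows "qpoch_inf a q \<noteq> 0"
  unfolding qpoch_inf_def
  by (rule prodinf_nonzero[OF convergent_prod_qpoch[OF assms(1)]]) (use assms(2) in force)

text \<open>The factors are grouped by the residue of their index modulo \<open>k\<close>; the
  partial products with \<open>n * k\<close> factors already agree.\<close>

lemma qpoch_inf_split:
  assumes "norm q < 1" "k > 0"
  shows "qpoch_inf a q = (\<Prod>j<k. qpoch_inf (a * q ^ j) (q ^ k))"
proof (rule LIMSEQ_unique)
  have "norm (q ^ k) < 1"
    using assms by (simp add: norm_power power_less_one_iff)
  then show "(\<lambda>n. \<Prod>j<k. qpoch (a * q ^ j) (q ^ k) n) \<longlonglongrightarrow> (\<Prod>j<k. qpoch_inf (a * q ^ j) (q ^ k))"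
    by (intro tendsto_prod qpoch_LIMSEQ)
  have "(\<lambda>n. qpoch a q (n * k)) \<longlonglongrightarrow> qpoch_inf a q"
    by (rule filterlim_compose[OF qpoch_LIMSEQ[OF assms(1)]])
      (use assms(2) in \<open>auto intro: filterlim_subseq simp: strict_mono_def\<close>)
  also have "(\<lambda>n. qpoch a q (n * k)) = (\<lambda>n. \<Prod>j<k. qpoch (a * q ^ j) (q ^ k) n)"
  proof
    fix n
    show "qpoch a q (n * k) = (\<Prod>j<k. qpoch (a * q ^ j) (q ^ k) n)"
    proof (induction n)
      case (Suc n)
      have "qpoch (a * q ^ (n * k)) q k = (\<Prod>j<k. 1 - a * q ^ j * (q ^ k) ^ n)"
        unfolding qpoch_def by (simp add: mult_ac flip: power_mult)
      then show ?case
        using qpoch_add[of a q "n * k" k] by (simp add: Suc.IH qpoch_Suc prod.distrib add.commute)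
    qed simp
  qed
  finally show "(\<lambda>n. \<Prod>j<k. qpoch (a * q ^ j) (q ^ k) n) \<longlonglongrightarrow> qpoch_inf a q" .
qed

section \<open>Absolute convergence of theta-like series\<close>

lemma summable_power_square:
  fixes s w :: complex
  assumes "norm s < 1"
  shows "summable (\<lambda>n. norm (w ^ n * s ^ n\<^sup>2))"
proof -
  \<comment> \<open>This is the ratio of consecutive terms, as
    \<open>(Suc n)\<^sup>2 - n\<^sup>2 = 2 * n + 1\<close>. It tends to 0 however large
    \<open>w\<close> is, which later admits negative powers of \<open>r\<close> and \<open>z\<close>
    in \<open>w\<close>.\<close>
  have "(\<lambda>n. norm w * norm s * (norm s ^ 2) ^ n) \<longlonglongrightarrow> norm w * norm s * 0"
    using assms by (intro tendsto_mult tendsto_const LIMSEQ_power_zero) (simp add: power_less_one_iff)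
  then have "eventually (\<lambda>n. norm w * norm s * (norm s ^ 2) ^ n < 1 / 2) sequentially"
    by (intro order_tendstoD) auto
  then obtain N where N: "\<And>n. n \<ge> N \<Longrightarrow> norm w * norm s * (norm s ^ 2) ^ n < 1 / 2"
    by (auto simp: eventually_sequentially)
  show ?thesis
  proof (rule summable_ratio_test[of "1 / 2" N])
    fix n assume "n \<ge> N"
    have "norm (w ^ Suc n * s ^ (Suc n)\<^sup>2) = norm w * norm s * (norm s ^ 2) ^ n * norm (w ^ n * s ^ n\<^sup>2)"
      by (simp add: norm_mult norm_power power2_eq_square power_add power_mult_distrib algebra_simps)
    also have "\<dots> \<le> 1 / 2 * norm (w ^ n * s ^ n\<^sup>2)"
      using N[OF \<open>n \<ge> N\<close>] by (intro mult_right_mono) auto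
    finally show "norm (norm (w ^ Suc n * s ^ (Suc n)\<^sup>2)) \<le> 1 / 2 * norm (norm (w ^ n * s ^ n\<^sup>2))"
      by simp
  qed simp
qed

lemma summable_quint_pos:
  assumes "norm r < 1"
  shows "summable (\<lambda>i. norm (quint_pos r z i))"
proof -
  have s: "norm (r ^ 3) < 1"
    using assms by (simp add: norm_power power_less_one_iff)
  have "quint_pos r z i = (- (z ^ 3) / r) ^ i * (r ^ 3) ^ i\<^sup>2 + z * ((- (z ^ 3) / r * r\<^sup>2) ^ i * (r ^ 3) ^ i\<^sup>2)" for i
  proof -
    have "(- (z ^ 3) / r) ^ i = (-1) ^ i * (z ^ 3 / r) ^ i"
      by (metis minus_divide_left power_minus)
    then show ?thesis
      by (simp only: quint_pos_def power_mult_distrib[of _ "r\<^sup>2"]) (simp add: ring_distribs mult_ac)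
  qed
  moreover have "summable (\<lambda>i. norm ((- (z ^ 3) / r) ^ i * (r ^ 3) ^ i\<^sup>2)
      + norm z * norm ((- (z ^ 3) / r * r\<^sup>2) ^ i * (r ^ 3) ^ i\<^sup>2))"
    by (intro summable_add summable_mult summable_power_square s)
  ultimately show ?thesis
    by (elim summable_comparison_test'[where N = 0]) (metis norm_mult norm_triangle_ineq real_norm_def abs_norm_cancel)
qed

lemma summable_quint_neg:
  assumes "norm r < 1"
  shows "summable (\<lambda>i. norm (quint_neg r z i))"
proof -
  have s: "norm (r ^ 3) < 1"
    using assms by (simp add: norm_power power_less_one_iff)
  have "quint_neg r z i = (- r / z ^ 3) ^ i * (r ^ 3) ^ i\<^sup>2 + z * ((- r / z ^ 3 / r\<^sup>2) ^ i * (r ^ 3) ^ i\<^sup>2)" for i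
  proof -
    have "(- r / z ^ 3) ^ i = (-1) ^ i * (r / z ^ 3) ^ i"
      by (metis minus_divide_left power_minus)
    then show ?thesis
      by (simp only: quint_neg_def power_divide[of _ "r\<^sup>2"]) (simp add: ring_distribs mult_ac)
  qed
  moreover have "summable (\<lambda>i. norm ((- r / z ^ 3) ^ i * (r ^ 3) ^ i\<^sup>2)
      + norm z * norm ((- r / z ^ 3 / r\<^sup>2) ^ i * (r ^ 3) ^ i\<^sup>2))"
    by (intro summable_add summable_mult summable_power_square s)
  ultimately show ?thesis
    by (elim summable_comparison_test'[where N = 0]) (metis norm_mult norm_triangle_ineq real_norm_def abs_norm_cancel)
qed

text \<open>The bilateral series is folded at its centre; \<open>quint_neg\<close> enters at
  \<open>Suc i\<close> because index 0 is already counted by \<open>quint_pos\<close>.\<close>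

theorem quintuple_product:
  assumes r: "r \<noteq> 0" "norm r < 1" and z: "z \<noteq> 0"
    and nz1: "\<And>i. z\<^sup>2 * (r\<^sup>2) ^ i \<noteq> 1" and nz2: "\<And>i. r\<^sup>2 / z\<^sup>2 * (r\<^sup>2) ^ i \<noteq> 1"
  shows "(\<lambda>i. quint_pos r z i + quint_neg r z (Suc i)) sums
    (qpoch_inf (r\<^sup>2) (r\<^sup>2) * qpoch_inf (z\<^sup>2) (r\<^sup>2) * qpoch_inf (r\<^sup>2 / z\<^sup>2) (r\<^sup>2)
      / (qpoch_inf z (r\<^sup>2) * qpoch_inf (r\<^sup>2 / z) (r\<^sup>2)))"
proof -
  define p where "p = r\<^sup>2"
  have p: "norm p < 1" "p \<noteq> 0"
    using r by (auto simp: p_def norm_power power_less_one_iff)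
  have p1: "p ^ Suc i \<noteq> 1" for i
  proof
    assume "p ^ Suc i = 1"
    then have "norm p ^ Suc i = 1"
      by (metis norm_one norm_power)
    then show False
      using p power_Suc_less_one[of "norm p" i] by simp
  qed
  have p1': "p * p ^ i \<noteq> 1" for i
    using p1[of i] by simp
  note nz = nz1[folded p_def] nz2[folded p_def]
  \<comment> \<open>The exponent of \<open>p\<close> in
    \<open>z\<^sup>2 * p ^ i / p ^ (2 * m)\<close> may have either sign: the first assumption
    handles the nonnegative case and the second, after inversion, the negative one.\<close>
  have x: "(z / p ^ m)\<^sup>2 * p ^ i \<noteq> 1" for m i
  proof (cases "2 * m \<le> i")
    case True
    then obtain d where "i = 2 * m + d"
      using le_Suc_ex by blast
    then have "(z / p ^ m)\<^sup>2 * p ^ i = z\<^sup>2 * p ^ d"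
      using p by (simp add: power_add power_divide mult.commute[of 2] power_mult)
    then show ?thesis
      using nz by simp
  next
    case False
    then obtain d where d: "2 * m = i + Suc d"
      by (metis add_Suc_right less_iff_Suc_add not_le)
    have "(z / p ^ m)\<^sup>2 * p ^ i = z\<^sup>2 * p ^ i / p ^ (2 * m)"
      by (simp add: power_divide power_mult power_mult_distrib power2_eq_square)
    also have "\<dots> = inverse (p / z\<^sup>2 * p ^ d)"
      unfolding d using p by (simp add: power_add field_simps)
    finally show ?thesis
      using nz by (metis inverse_eq_1_iff)
  qed
  define U where "U = (\<lambda>m. qpoch p p (2 * m) * qpoch (p / z) p m * qpoch z p (Suc m))"
  define V where "V = (\<lambda>a. 1 / (qpoch p p a * qpoch (z\<^sup>2) p (Suc a)))"
  define V' where "V' = (\<lambda>b. 1 / (qpoch p p b * qpoch (p / z\<^sup>2) p b))"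
  define u where "u = qpoch_inf p p * qpoch_inf (p / z) p * qpoch_inf z p"
  define v where "v = 1 / (qpoch_inf p p * qpoch_inf (z\<^sup>2) p)"
  define v' where "v' = 1 / (qpoch_inf p p * qpoch_inf (p / z\<^sup>2) p)"
  have inf_nz: "qpoch_inf p p \<noteq> 0" "qpoch_inf (z\<^sup>2) p \<noteq> 0" "qpoch_inf (p / z\<^sup>2) p \<noteq> 0"
    by (intro qpoch_inf_nonzero p p1' nz)+
  note lim = qpoch_LIMSEQ[OF p(1)]
  have "(\<lambda>m. qpoch p p (2 * m)) \<longlonglongrightarrow> qpoch_inf p p"
    by (rule filterlim_compose[OF lim]) (auto intro: filterlim_subseq simp: strict_mono_def)
  then have U: "U \<longlonglongrightarrow> u"
    unfolding U_def u_def by (intro tendsto_mult lim LIMSEQ_Suc)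
  have V: "V \<longlonglongrightarrow> v" and V': "V' \<longlonglongrightarrow> v'"
    unfolding V_def v_def V'_def v'_def
    using inf_nz by (intro tendsto_divide tendsto_const tendsto_mult lim LIMSEQ_Suc; simp)+
  have W: "quint_weight p z m a b = U m * V a * V' b" for m a b
    by (simp add: quint_weight_def U_def V_def V'_def)
  obtain BU BV BV' where B: "\<And>n. norm (U n) \<le> BU" "\<And>n. norm (V n) \<le> BV" "\<And>n. norm (V' n) \<le> BV'"
    using U V V' by (meson BseqE Bseq_conv_Bfun convergent_imp_Bseq convergentI)
  define B where "B = BU * BV * BV'"
  have B0: "0 \<le> BU" "0 \<le> BV" "0 \<le> BV'"
    using B norm_ge_zero order_trans by blast+
  have WB: "norm (quint_weight p z m a b) \<le> B" for m a b
    unfolding W B_def norm_mult using B B0 by (intro mult_mono mult_nonneg_nonneg) auto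
  have "0 \<le> B"
    unfolding B_def using B0 by simp
  \<comment> \<open>Row \<open>m\<close> pairs the summands at \<open>m + i\<close> and
    \<open>m - Suc i\<close>; the conditions cut off indices outside the range from 0 to
    \<open>2 * m\<close>.\<close>
  define f where "f = (\<lambda>i m.
     (if i \<le> m then quint_pos r z i * quint_weight p z m (m + i) (m - i) else 0) +
     (if Suc i \<le> m then quint_neg r z (Suc i) * quint_weight p z m (m - Suc i) (m + Suc i) else 0))"
  define g where "g = (\<lambda>i. (quint_pos r z i + quint_neg r z (Suc i)) * (u * v * v'))"
  have pos: "(\<lambda>m. quint_weight p z m (m + i) (m - i)) \<longlonglongrightarrow> u * v * v'"
    and neg: "(\<lambda>m. quint_weight p z m (m - i) (m + i)) \<longlonglongrightarrow> u * v * v'" for i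
    unfolding W
    by (intro tendsto_mult U filterlim_compose[OF V] filterlim_compose[OF V']
        filterlim_add_const_nat_at_top filterlim_minus_const_nat_at_top)+
  have lim_f: "f i \<longlonglongrightarrow> g i" for i
  proof -
    have "(\<lambda>m. quint_pos r z i * quint_weight p z m (m + i) (m - i)
        + quint_neg r z (Suc i) * quint_weight p z m (m - Suc i) (m + Suc i)) \<longlonglongrightarrow> g i"
      unfolding g_def distrib_right by (intro tendsto_add tendsto_mult tendsto_const pos neg)
    then show ?thesis
    proof (rule Lim_transform_eventually)
      show "eventually (\<lambda>m. quint_pos r z i * quint_weight p z m (m + i) (m - i)
        + quint_neg r z (Suc i) * quint_weight p z m (m - Suc i) (m + Suc i) = f i m) sequentially"
        using eventually_ge_at_top[of "Suc i"] by eventually_elim (simp add: f_def)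
    qed
  qed
  \<comment> \<open>The majorant for Tannery's theorem: free of \<open>m\<close>, since
    \<open>B\<close> bounds all weights.\<close>
  define M where "M = (\<lambda>i. (norm (quint_pos r z i) + norm (quint_neg r z (Suc i))) * B)"
  have f_le: "norm (f i m) \<le> M i" for i m
  proof -
    have "norm (f i m) \<le> norm (quint_pos r z i) * B + norm (quint_neg r z (Suc i)) * B"
      unfolding f_def
      by (intro norm_triangle_le add_mono)
        (use WB \<open>0 \<le> B\<close> in \<open>auto simp: norm_mult intro!: mult_left_mono\<close>)
    then show ?thesis
      by (simp add: M_def distrib_right)
  qed
  have "summable (\<lambda>i. norm (quint_neg r z (Suc i)))"
    using summable_quint_neg[OF r(2)] by (simp add: summable_Suc_iff[of "\<lambda>i. norm (quint_neg r z i)"])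
  then have sM: "summable M"
    unfolding M_def by (intro summable_mult2 summable_add summable_quint_pos r(2))
  \<comment> \<open>Each row is the finite identity for \<open>2 * m\<close> and
    \<open>z / p ^ m\<close>, read outwards from the centre.\<close>
  have f1: "(\<Sum>i. f i m) = 1" for m
  proof -
    let ?t = "quint_term p (z / p ^ m) (2 * m)"
    have "(\<Sum>i. f i m) = (\<Sum>i\<le>m. f i m)"
      by (rule suminf_finite) (auto simp: f_def)
    also have "\<dots> = (\<Sum>i\<le>m. ?t (m + i)) + (\<Sum>i<m. ?t (m - Suc i))"
    proof -
      have "(\<Sum>i\<le>m. if Suc i \<le> m then ?t (m - Suc i) else 0) = (\<Sum>i<m. ?t (m - Suc i))"
        by (rule sum.mono_neutral_cong_right) auto
      moreover have "(\<Sum>i\<le>m. f i m) = (\<Sum>i\<le>m. ?t (m + i) + (if Suc i \<le> m then ?t (m - Suc i) else 0))"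
        unfolding f_def p_def
        by (intro sum.cong) (use r z quint_term_pos quint_term_neg in auto)
      ultimately show ?thesis
        by (simp add: sum.distrib)
    qed
    also have "\<dots> = (\<Sum>k=m..2*m. ?t k) + (\<Sum>k<m. ?t k)"
      using sum.nat_diff_reindex[of ?t m] sum.shift_bounds_cl_nat_ivl[of ?t 0 m m]
      by (simp add: atLeast0AtMost mult_2 add.commute)
    also have "\<dots> = (\<Sum>k\<le>2*m. ?t k)"
      by (subst sum.union_disjoint[symmetric]) (auto intro!: sum.cong)
    also have "\<dots> = 1"
      by (rule finite_quintuple_product) (use p1 x in auto)
    finally show ?thesis .
  qed
  have "summable (\<lambda>i. norm (g i)) \<and> (\<lambda>m. \<Sum>i. f i m) \<longlonglongrightarrow> suminf g"
    using tannerys_theorem[of f g sequentially M, OF lim_f _ sM] f_le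
    by (simp add: always_eventually case_prod_unfold)
  then have "summable g" "suminf g = 1"
    unfolding f1 using LIMSEQ_unique tendsto_const by (blast intro: summable_norm_cancel)+
  then have "g sums 1"
    by (simp add: sums_iff)
  \<comment> \<open>A vanishing constant would make \<open>g\<close> sum to 0 instead of 1. Hence
    the products in \<open>z\<close> and \<open>p / z\<close> that end up in the denominator satisfy
    no separate assumption but inherit convergence to a nonzero \<open>u\<close>.\<close>
  moreover from this have c: "u * v * v' \<noteq> 0"
    unfolding g_def using sums_unique2[OF sums_zero] by fastforce
  ultimately have "(\<lambda>i. quint_pos r z i + quint_neg r z (Suc i)) sums (1 / (u * v * v'))"
    using sums_divide[of g 1 "u * v * v'"] by (simp add: g_def)
  also have "1 / (u * v * v') = qpoch_inf p p * qpoch_inf (z\<^sup>2) p * qpoch_inf (p / z\<^sup>2) p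
      / (qpoch_inf z p * qpoch_inf (p / z) p)"
    using c inf_nz unfolding u_def v_def v'_def by (simp add: field_simps)
  finally show ?thesis
    by (simp add: p_def)
qed

section \<open>The indices of squares and the specialised series\<close>

text \<open>Each value is the least element of the range not yet listed. This identifies a sequence
  given by enumeration with an explicit one.\<close>

lemma strict_mono_range_unique:
  fixes f g :: "nat \<Rightarrow> 'a :: linorder"
  assumes "strict_mono f" "strict_mono g" "range f = range g"
  shows "f = g"
proof
  fix n
  have le: "f' n \<le> g' n"
    if *: "strict_mono f'" "strict_mono g'" "range f' = range g'" "\<And>k. k < n \<Longrightarrow> f' k = g' k"
    for f' g' :: "nat \<Rightarrow> 'a" and n
  proof -
    obtain m where m: "g' n = f' m"
      using *(3) by (metis rangeE rangeI)
    have "\<not> m < n"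
      using m *(2,4) by (metis less_irrefl strict_mono_eq)
    then show ?thesis
      using m *(1) by (simp add: strict_mono_less_eq)
  qed
  show "f n = g n"
  proof (induction n rule: less_induct)
    case (less n)
    then show ?case
      using le[of f g n] le[of g f n] assms by (simp add: order_antisym)
  qed
qed

text \<open>The increasing list of the naturals whose square is 4 modulo 15: the residues are 2, 7,
  8 and 13.\<close>

definition sq_root :: "nat \<Rightarrow> nat" where
  "sq_root n = 15 * (n div 4) + [2, 7, 8, 13] ! (n mod 4)"

lemma sq_root_simps:
  "sq_root (4 * j) = 15 * j + 2" "sq_root (4 * j + 1) = 15 * j + 7"
  "sq_root (4 * j + 2) = 15 * j + 8" "sq_root (4 * j + 3) = 15 * j + 13"
  by (simp_all add: sq_root_def del: add_2_eq_Suc' One_nat_def)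

lemma mod_4_cases:
  fixes n :: nat
  obtains j where "n = 4 * j" | j where "n = 4 * j + 1" | j where "n = 4 * j + 2" | j where "n = 4 * j + 3"
proof -
  have "n = 4 * (n div 4) \<or> n = 4 * (n div 4) + 1 \<or> n = 4 * (n div 4) + 2 \<or> n = 4 * (n div 4) + 3"
    by presburger
  then show ?thesis
    using that by blast
qed

lemma strict_mono_sq_root: "strict_mono sq_root"
  unfolding strict_mono_Suc_iff
proof
  fix n
  show "sq_root n < sq_root (Suc n)"
  proof (cases n rule: mod_4_cases)
    case (4 j)
    then have "Suc n = 4 * Suc j"
      by simp
    then show ?thesis
      using 4 by (simp only: sq_root_simps)
  qed (use sq_root_simps in \<open>simp_all add: numeral_3_eq_3\<close>)
qed

lemma sq_root_square_mod: "(sq_root n)\<^sup>2 mod 15 = 4"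
proof -
  have "(15 * j + c)\<^sup>2 mod 15 = c\<^sup>2 mod 15" for j c :: nat
    by (metis mod_mult_self4 power_mod)
  then show ?thesis
    by (cases n rule: mod_4_cases) (simp_all only: sq_root_simps, simp_all)
qed

lemma sq_root_surj:
  assumes "s\<^sup>2 mod 15 = (4 :: nat)"
  shows "s \<in> range sq_root"
proof -
  define t where "t = s mod 15"
  have "t\<^sup>2 mod 15 = 4"
    using assms by (simp add: t_def power_mod)
  moreover have "t < 15"
    by (simp add: t_def)
  then have "t \<in> {0, 1, 2, 3, 4, 5, 6, 7, 8, 9, 10, 11, 12, 13, 14}"
    unfolding insert_iff empty_iff by presburger
  ultimately have "t = 2 \<or> t = 7 \<or> t = 8 \<or> t = 13"
    by auto
  moreover have "s = 15 * (s div 15) + t"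
    by (simp add: t_def)
  ultimately show ?thesis
    by (metis rangeI sq_root_simps)
qed

text \<open>Both sides increase strictly in \<open>n\<close> and run through the squares that are 4
  modulo 15.\<close>

lemma a_seq_sq_root: "15 * a_seq n + 4 = (sq_root n)\<^sup>2"
proof -
  have "(\<lambda>n. 15 * a_seq n + 4) = (\<lambda>n. (sq_root n)\<^sup>2)"
  proof (rule strict_mono_range_unique)
    show "strict_mono (\<lambda>n. 15 * a_seq n + 4)"
      using strict_mono_a_seq by (simp add: strict_mono_def)
    show "strict_mono (\<lambda>n. (sq_root n)\<^sup>2)"
      using strict_mono_sq_root by (auto simp: strict_mono_def intro!: power_strict_mono)
    have "range (\<lambda>n. 15 * a_seq n + 4) = (\<lambda>m. 15 * m + 4) ` square_indices"
      unfolding range_a_seq[symmetric] by auto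
    also have "\<dots> = {s\<^sup>2 | s. s\<^sup>2 mod 15 = 4}"
    proof (intro equalityI subsetI)
      fix y assume "y \<in> (\<lambda>m. 15 * m + 4) ` square_indices"
      then obtain m s where y: "y = 15 * m + 4" "y = s\<^sup>2"
        unfolding square_indices_def is_nth_power_def by blast
      have "y mod 15 = 4"
        unfolding y(1) by simp
      then show "y \<in> {s\<^sup>2 | s. s\<^sup>2 mod 15 = 4}"
        using y(2) by blast
    next
      fix y :: nat assume "y \<in> {s\<^sup>2 | s. s\<^sup>2 mod 15 = 4}"
      then obtain s where s: "y = s\<^sup>2" "s\<^sup>2 mod 15 = 4"
        by auto
      then have "y = 15 * (s\<^sup>2 div 15) + 4"
        by (metis mult_div_mod_eq)
      moreover from this have "s\<^sup>2 div 15 \<in> square_indices"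
        unfolding square_indices_def using s(1) by (auto simp: is_nth_power_def)
      ultimately show "y \<in> (\<lambda>m. 15 * m + 4) ` square_indices"
        by auto
    qed
    also have "\<dots> = range (\<lambda>n. (sq_root n)\<^sup>2)"
      using sq_root_surj sq_root_square_mod by auto
    finally show "range (\<lambda>n. 15 * a_seq n + 4) = range (\<lambda>n. (sq_root n)\<^sup>2)" .
  qed
  then show ?thesis
    by meson
qed

lemma a_seq_simps:
  "a_seq (4 * j) = 15 * j\<^sup>2 + 4 * j" "a_seq (4 * j + 1) = 15 * j\<^sup>2 + 14 * j + 3"
  "a_seq (4 * j + 2) = 15 * j\<^sup>2 + 16 * j + 4" "a_seq (4 * j + 3) = 15 * j\<^sup>2 + 26 * j + 11"
  using a_seq_sq_root[of "4 * j"] a_seq_sq_root[of "4 * j + 1"]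
    a_seq_sq_root[of "4 * j + 2"] a_seq_sq_root[of "4 * j + 3"]
  unfolding sq_root_simps by (simp_all add: power2_eq_square algebra_simps)

section \<open>The series regrouped in blocks of four\<close>

lemma summable_a_seq:
  fixes q :: complex
  assumes "norm q < 1"
  shows "summable (\<lambda>n. (-1) ^ ((n + 2) div 4) * q ^ a_seq n)"
proof (rule summable_comparison_test')
  show "summable (\<lambda>n. norm q ^ n)"
    using assms by (intro summable_geometric) simp
  fix n
  have "n \<le> a_seq n"
    by (rule strict_mono_imp_increasing[OF strict_mono_a_seq])
  then show "norm ((-1) ^ ((n + 2) div 4) * q ^ a_seq n) \<le> norm q ^ n"
    using assms by (simp add: norm_mult norm_power power_decreasing)
qed

text \<open>Here \<open>z ^ 3 / r\<close> is \<open>q ^ 4\<close> and \<open>r\<^sup>2\<close> is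
  \<open>q ^ 10\<close>. The sign exponent is \<open>j\<close> on the first two terms of a block and
  \<open>Suc j\<close> on the last two, as in the two halves of the series.\<close>

lemma quint_pos_neg_a_seq:
  fixes q :: complex
  assumes "q \<noteq> 0"
  shows "quint_pos (q ^ 5) (q ^ 3) j + quint_neg (q ^ 5) (q ^ 3) (Suc j) =
    (\<Sum>n=j*4..<j*4+4. (-1) ^ ((n + 2) div 4) * q ^ a_seq n)"
proof -
  have "quint_pos (q ^ 5) (q ^ 3) j = (-1) ^ j * (q ^ a_seq (4 * j) + q ^ a_seq (4 * j + 1))"
  proof -
    have "((q ^ 3) ^ 3 / q ^ 5) = q ^ 4"
      using assms by (simp add: field_simps flip: power_mult power_add)
    moreover have "q ^ (14 * j) = q ^ (4 * j) * q ^ (10 * j)"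
      by (simp flip: power_add)
    ultimately show ?thesis
      unfolding quint_pos_def a_seq_simps power_add power_mult[symmetric]
      by (simp add: ring_distribs mult.left_commute flip: power_mult)
  qed
  moreover have "quint_neg (q ^ 5) (q ^ 3) (Suc j) =
      (-1) ^ Suc j * (q ^ a_seq (4 * j + 2) + q ^ a_seq (4 * j + 3))"
  proof -
    let ?i = "Suc j"
    have 1: "q ^ 5 / (q ^ 3) ^ 3 = 1 / q ^ 4"
      using assms by (simp add: field_simps flip: power_mult power_add)
    \<comment> \<open>The exponents 15i^2 - 4i and 15i^2 - 14i + 3 at \<open>i = Suc j\<close>,
      stated additively because subtraction on naturals truncates. The first one is the larger, so
      the two terms appear in reversed order.\<close>
    have "15 * ?i\<^sup>2 = a_seq (4 * j + 3) + 4 * ?i"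
      "15 * ?i\<^sup>2 + 3 = a_seq (4 * j + 2) + 4 * ?i + 10 * ?i"
      unfolding a_seq_simps by (simp_all add: power2_eq_square)
    then have "q ^ (15 * ?i\<^sup>2) = q ^ a_seq (4 * j + 3) * q ^ (4 * ?i)"
      "q ^ (15 * ?i\<^sup>2) * q ^ 3 = q ^ a_seq (4 * j + 2) * q ^ (4 * ?i) * q ^ (10 * ?i)"
      by (metis power_add)+
    then have 2: "q ^ (15 * ?i\<^sup>2) / q ^ (4 * ?i) = q ^ a_seq (4 * j + 3)"
      "q ^ (15 * ?i\<^sup>2) * q ^ 3 / (q ^ (4 * ?i) * q ^ (10 * ?i)) = q ^ a_seq (4 * j + 2)"
      using assms by (simp_all add: field_simps)
    have "quint_neg (q ^ 5) (q ^ 3) ?i = (-1) ^ ?i * (q ^ (15 * ?i\<^sup>2) / q ^ (4 * ?i)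
        + q ^ (15 * ?i\<^sup>2) * q ^ 3 / (q ^ (4 * ?i) * q ^ (10 * ?i)))"
      unfolding quint_neg_def 1 unfolding power_one_over power_mult[symmetric]
      by (simp add: ring_distribs del: power_Suc mult_Suc_right)
    also have "\<dots> = (-1) ^ Suc j * (q ^ a_seq (4 * j + 2) + q ^ a_seq (4 * j + 3))"
      unfolding 2 by (simp only: add.commute)
    finally show ?thesis .
  qed
  moreover have "(\<Sum>n=j*4..<j*4+4. f n) = f (4 * j) + f (4 * j + 1) + f (4 * j + 2) + f (4 * j + 3)"
    for f :: "nat \<Rightarrow> complex"
    by (simp add: numeral_eq_Suc mult.commute)
  moreover have "(4 * j + 2) div 4 = j" "(4 * j + 1 + 2) div 4 = j"
    "(4 * j + 2 + 2) div 4 = Suc j" "(4 * j + 3 + 2) div 4 = Suc j"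
    by presburger+
  ultimately show ?thesis
    by (simp only: distrib_left add.assoc)
qed

section \<open>Dissection of the product side\<close>

lemma qpoch_inf_power_split:
  assumes "norm q < 1" "b > 0" "k > 0"
  shows "qpoch_inf (q ^ a) (q ^ b) = (\<Prod>j<k. qpoch_inf (q ^ (a + b * j)) (q ^ (b * k)))"
proof -
  have "norm (q ^ b) < 1"
    using assms by (simp add: norm_power power_less_one_iff)
  then show ?thesis
    using qpoch_inf_split[of "q ^ b" k "q ^ a"] assms(3) by (simp add: power_add power_mult)
qed

text \<open>Both sides equal \<open>qpoch_inf (q ^ 2) (q ^ 2)\<close>: repeated halving gives the
  left one, a split into five classes the right one.\<close>

lemma even_qpoch_inf_product:
  assumes "norm q < 1"
  shows "qpochs_inf [q ^ 2, q ^ 6, q ^ 8] (q ^ 8) * qpochs_inf [q ^ 4, q ^ 12] (q ^ 16) =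
    qpoch_inf (q ^ 2) (q ^ 10) * qpoch_inf (q ^ 4) (q ^ 10) * qpoch_inf (q ^ 6) (q ^ 10)
    * qpoch_inf (q ^ 8) (q ^ 10) * qpoch_inf (q ^ 10) (q ^ 10)"
proof -
  note split = qpoch_inf_power_split[OF assms]
  have "qpoch_inf (q ^ 2) (q ^ 2) = qpoch_inf (q ^ 2) (q ^ 4) * qpoch_inf (q ^ 4) (q ^ 4)"
    using split[of 2 2 2] by (simp add: lessThan_nat_numeral mult_ac del: add_2_eq_Suc)
  moreover have "qpoch_inf (q ^ 2) (q ^ 4) = qpoch_inf (q ^ 2) (q ^ 8) * qpoch_inf (q ^ 6) (q ^ 8)"
    using split[of 4 2 2] by (simp add: lessThan_nat_numeral mult_ac del: add_2_eq_Suc)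
  moreover have "qpoch_inf (q ^ 4) (q ^ 4) = qpoch_inf (q ^ 4) (q ^ 8) * qpoch_inf (q ^ 8) (q ^ 8)"
    using split[of 4 2 4] by (simp add: lessThan_nat_numeral mult_ac del: add_2_eq_Suc)
  moreover have "qpoch_inf (q ^ 4) (q ^ 8) = qpoch_inf (q ^ 4) (q ^ 16) * qpoch_inf (q ^ 12) (q ^ 16)"
    using split[of 8 2 4] by (simp add: lessThan_nat_numeral mult_ac del: add_2_eq_Suc)
  moreover have "qpoch_inf (q ^ 2) (q ^ 2) = qpoch_inf (q ^ 2) (q ^ 10) * qpoch_inf (q ^ 4) (q ^ 10)
      * qpoch_inf (q ^ 6) (q ^ 10) * qpoch_inf (q ^ 8) (q ^ 10) * qpoch_inf (q ^ 10) (q ^ 10)"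
    using split[of 2 5 2] by (simp add: lessThan_nat_numeral mult_ac del: add_2_eq_Suc)
  ultimately show ?thesis
    by (simp add: qpochs_inf_def mult_ac)
qed

theorem theorem12:
  fixes q :: complex
  assumes "norm q < 1"
  shows "(\<lambda>n. (-1) ^ ((n + 2) div 4) * q ^ a_seq n) sums
    (qpochs_inf [q ^ 2, q ^ 6, q ^ 8] (q ^ 8) * qpochs_inf [q ^ 4, q ^ 12] (q ^ 16)
      / qpochs_inf [q ^ 2, q ^ 3] (q ^ 5))"
\<comment> \<open>The quintuple terms divide by \<open>q\<close>, so \<open>q = 0\<close> is
  separate; there only \<open>n = 0\<close> contributes, through \<open>0 ^ 0 = 1\<close>.\<close>
proof (cases "q = 0")
  case True
  have a0: "a_seq 0 = 0"
    using a_seq_simps(1)[of 0] by simp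
  then have "0 < n \<Longrightarrow> 0 < a_seq n" for n
    using strict_mono_less[OF strict_mono_a_seq, of 0 n] by simp
  then have "(-1) ^ ((n + 2) div 4) * q ^ a_seq n = (if n = 0 then 1 else 0)" for n
    by (cases "n = 0") (simp_all add: True a0)
  moreover have "(\<lambda>n. if n = 0 then 1 else 0) sums (1 :: complex)"
    using sums_single[of 0 "\<lambda>_. 1 :: complex"] by simp
  moreover have "qpochs_inf [q ^ 2, q ^ 6, q ^ 8] (q ^ 8) * qpochs_inf [q ^ 4, q ^ 12] (q ^ 16)
      / qpochs_inf [q ^ 2, q ^ 3] (q ^ 5) = 1"
    by (simp add: True qpochs_inf_def qpoch_inf_def)
  ultimately show ?thesis
    by simp
next
  case False
  have q: "norm (q ^ k) < 1" if "k > 0" for k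
    using assms that by (simp add: norm_power power_less_one_iff)
  have q1: "q ^ k \<noteq> 1" if "k > 0" for k
    using q[OF that] by auto
  let ?s = "\<lambda>n. (-1) ^ ((n + 2) div 4) * q ^ a_seq n"
  have e: "(q ^ 5)\<^sup>2 = q ^ 10" "(q ^ 3)\<^sup>2 = q ^ 6" "q ^ 10 / q ^ 6 = q ^ 4" "q ^ 10 / q ^ 3 = q ^ 7"
    using False by (simp_all add: field_simps flip: power_mult power_add)
  have "(\<lambda>j. quint_pos (q ^ 5) (q ^ 3) j + quint_neg (q ^ 5) (q ^ 3) (Suc j)) sums
    (qpoch_inf (q ^ 10) (q ^ 10) * qpoch_inf (q ^ 6) (q ^ 10) * qpoch_inf (q ^ 4) (q ^ 10)
      / (qpoch_inf (q ^ 3) (q ^ 10) * qpoch_inf (q ^ 7) (q ^ 10)))"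
  proof (rule quintuple_product[of "q ^ 5" "q ^ 3", unfolded e])
    show "q ^ 6 * (q ^ 10) ^ i \<noteq> 1" "q ^ 4 * (q ^ 10) ^ i \<noteq> 1" for i
      unfolding power_mult[symmetric] power_add[symmetric] by (rule q1; simp)+
  qed (use False q in auto)
  \<comment> \<open>Summability of the ungrouped series is already known, so grouping by four
    preserves the sum.\<close>
  moreover have "(\<lambda>j. quint_pos (q ^ 5) (q ^ 3) j + quint_neg (q ^ 5) (q ^ 3) (Suc j)) sums suminf ?s"
    unfolding quint_pos_neg_a_seq[OF False]
    by (rule sums_group) (use summable_sums[OF summable_a_seq[OF assms]] in auto)
  ultimately have "suminf ?s = qpoch_inf (q ^ 10) (q ^ 10) * qpoch_inf (q ^ 6) (q ^ 10)
      * qpoch_inf (q ^ 4) (q ^ 10) / (qpoch_inf (q ^ 3) (q ^ 10) * qpoch_inf (q ^ 7) (q ^ 10))"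
    by (rule sums_unique2[rotated])
  also have "\<dots> = qpochs_inf [q ^ 2, q ^ 6, q ^ 8] (q ^ 8) * qpochs_inf [q ^ 4, q ^ 12] (q ^ 16)
      / qpochs_inf [q ^ 2, q ^ 3] (q ^ 5)"
  proof -
    have "qpoch_inf (q ^ 2) (q ^ 5) = qpoch_inf (q ^ 2) (q ^ 10) * qpoch_inf (q ^ 7) (q ^ 10)"
      using qpoch_inf_power_split[OF assms, of 5 2 2] by (simp add: lessThan_nat_numeral mult_ac del: add_2_eq_Suc)
    moreover have "qpoch_inf (q ^ 3) (q ^ 5) = qpoch_inf (q ^ 3) (q ^ 10) * qpoch_inf (q ^ 8) (q ^ 10)"
      using qpoch_inf_power_split[OF assms, of 5 2 3] by (simp add: lessThan_nat_numeral mult_ac del: add_2_eq_Suc)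
    \<comment> \<open>Needed to cancel the products starting at \<open>q ^ 2\<close> and
      \<open>q ^ 8\<close>, which occur in both numerator and denominator.\<close>
    moreover have "qpoch_inf (q ^ k) (q ^ 10) \<noteq> 0" if "k > 0" for k
    proof (rule qpoch_inf_nonzero)
      show "q ^ k * (q ^ 10) ^ i \<noteq> 1" for i
        unfolding power_mult[symmetric] power_add[symmetric] by (rule q1) (use that in simp)
    qed (simp add: q)
    ultimately show ?thesis
      unfolding even_qpoch_inf_product[OF assms] by (simp add: qpochs_inf_def field_simps)
  qed
  finally show ?thesis
    using summable_sums[OF summable_a_seq[OF assms]] by simp
qed

end
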